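(* Let $1 \leq t \leq r_1 \leq \dots \leq r_k$ (with $k\geq 2$), and for each $i \in [k]$ let $\mathcal{F}_i = \mathcal{M}_{n_i,r_i}$ with $n_i \geq (r_i-t)\,c(r_{k-1},r_k,t) - r_i + t + 1$. Then $(\mathcal{F}_1, \dots, \mathcal{F}_k)$ has the extrastrong cross-$t$-star property.
   Context: A multiset may contain repeated members; $m_A(a)$ is the multiplicity of $a$ in $A$. A multiset $A$ with distinct members $a_1,\dots,a_q$ is represented by the set $S_A=\{(a_i,j): i\in[q], j\in[m_A(a_i)]\}$. $M_{n,r}$ is the set of multisets with members in $[n]$ of total size $r$ (counting repetitions), and $\mathcal{M}_{n,r}=\{S_A: A\in M_{n,r}\}$. $c(r,s,t)=\max\{r\binom{s}{t},s\binom{r}{t}\}+1$ if $t\leq\min\{r,s\}$, and $1$ otherwise. $\mathcal{F}(T)=\{F\in\mathcal{F}:T\subseteq F\}$. Families $\mathcal{A}_1,\dots,\mathcal{A}_k$ are cross-$t$-intersecting if for all distinct $i,j$ each set of $\mathcal{A}_i$ shares at least $t$ elements with each set of $\mathcal{A}_j$; the tuple is below $(\mathcal{F}_1,\dots,\mathcal{F}_k)$ if $\mathcal{A}_i\subseteq\mathcal{F}_i$. Extrastrong cross-$t$-star property: there is a $t$-set $T$ such that for every cross-$t$-intersecting tuple below $(\mathcal{F}_1,\dots,\mathcal{F}_k)$, $\prod|\mathcal{A}_i|\leq\prod|\mathcal{F}_i(T)|$, with equality only if there is a $t$-set $T'$ with $\mathcal{A}_i=\mathcal{F}_i(T')$ for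 all $i$. *)

theory Defs
  imports Complex_Main "HOL-Library.Multiset"
begin

text \<open>The set \<open>S\<^sub>A\<close>: the copies of each member \<open>a\<close> are numbered from 1.\<close>

definition mset_rep :: "'a multiset \<Rightarrow> ('a \<times> nat) set" where
  "mset_rep A = {(a, j). a \<in># A \<and> j \<in> {1..count A a}}"

definition mset_family :: "nat \<Rightarrow> nat \<Rightarrow> (nat \<times> nat) set set" where
  "mset_family n r = mset_rep ` multisets_of_size {1..n} r"

definition c_bound :: "nat \<Rightarrow> nat \<Rightarrow> nat \<Rightarrow> nat" where
  "c_bound r s t = (if t \<le> min r s then max (r * (s choose t)) (s * (r choose t)) + 1 else 1)"

definition star :: "'a set set \<Rightarrow> 'a set \<Rightarrow> 'a set set" where
  "star \<F> T = {F \<in> \<F>. T \<subseteq> F}"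

text \<open>Tuples of families are functions on \<open>nat\<close> of which only the values at
  \<open>1, \<dots>, k\<close> matter.  The notions below are meant for families of finite sets
  that are themselves finite, so that \<^const>\<open>card\<close> is the true cardinality.\<close>

definition cross_intersecting :: "nat \<Rightarrow> nat \<Rightarrow> (nat \<Rightarrow> 'a set set) \<Rightarrow> bool" where
  "cross_intersecting t k \<A> \<longleftrightarrow>
     (\<forall>i\<in>{1..k}. \<forall>j\<in>{1..k}. i \<noteq> j \<longrightarrow> (\<forall>A\<in>\<A> i. \<forall>B\<in>\<A> j. t \<le> card (A \<inter> B)))"

definition tuple_below :: "nat \<Rightarrow> (nat \<Rightarrow> 'a set set) \<Rightarrow> (nat \<Rightarrow> 'a set set) \<Rightarrow> bool" where
  "tuple_below k \<A> \<F> \<longleftrightarrow> (\<forall>i\<in>{1..k}. \<A> i \<subseteq> \<F> i)"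

definition extrastrong_cross_star :: "nat \<Rightarrow> nat \<Rightarrow> (nat \<Rightarrow> 'a set set) \<Rightarrow> bool" where
  "extrastrong_cross_star t k \<F> \<longleftrightarrow>
     (\<exists>T. finite T \<and> card T = t \<and>
       (\<forall>\<A>. tuple_below k \<A> \<F> \<and> cross_intersecting t k \<A> \<longrightarrow>
          (\<Prod>i\<in>{1..k}. card (\<A> i)) \<le> (\<Prod>i\<in>{1..k}. card (star (\<F> i) T)) \<and>
          ((\<Prod>i\<in>{1..k}. card (\<A> i)) = (\<Prod>i\<in>{1..k}. card (star (\<F> i) T)) \<longrightarrow>
             (\<exists>T'. finite T' \<and> card T' = t \<and> (\<forall>i\<in>{1..k}. \<A> i = star (\<F> i) T')))))"

end

theory Submission imports Defs begin

text \<open>Choose a \<open>t\<close>-set \<open>T\<close> whose star has the maximal size \<open>L\<^sub>i\<close> in every family, and let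
  \<open>L\<^sub>i'\<close> bound the stars of \<open>(t+1)\<close>-sets in the \<open>i\<close>-th family. For two cross-\<open>t\<close>-intersecting
  families, each set of one contains a \<open>t\<close>-subset of any fixed set of the other; if that
  \<open>t\<close>-subset is not common to the other family, a further element is forced. Hence, unless both families
  lie in the star of the same \<open>t\<close>-set, at least one factor \<open>L\<^sub>i\<close> is traded for \<open>L\<^sub>i'\<close> at the cost of
  a constant, which the lower bound on \<open>n\<^sub>i\<close> makes a loss. The case of \<open>k\<close> families follows by
  multiplying over all pairs.\<close>

section \<open>Covering a family by stars of small sets\<close>

lemma finite_star: "finite F \<Longrightarrow> finite (star F T)"
  by (simp add: star_def)

text \<open>Each member of \<open>\<A>\<close> contains some \<open>t\<close>-subset of
  \<open>B\<close>, so the stars of the \<open>card B choose t\<close> such subsets cover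
  \<open>\<A>\<close>, and the union bound applies.\<close>

lemma card_le_of_meets:
  assumes "finite \<A>" "finite B" and "\<And>A. A \<in> \<A> \<Longrightarrow> t \<le> card (A \<inter> B)"
    and K: "\<And>T. T \<subseteq> B \<Longrightarrow> card T = t \<Longrightarrow> card (star \<A> T) \<le> K"
  shows "card \<A> \<le> (card B choose t) * K"
proof -
  let ?I = "{T. T \<subseteq> B \<and> card T = t}"
  have fin: "finite ?I" using assms(2) by simp
  have "\<A> \<subseteq> (\<Union>T\<in>?I. star \<A> T)"
  proof
    fix A assume A: "A \<in> \<A>"
    obtain T where "T \<subseteq> A \<inter> B" "card T = t"
      using assms(3)[OF A] obtain_subset_with_card_n by metis
    with A show "A \<in> (\<Union>T\<in>?I. star \<A> T)" by (auto simp: star_def)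
  qed
  moreover have "(\<Union>T\<in>?I. star \<A> T) \<subseteq> \<A>" by (auto simp: star_def)
  ultimately have "card \<A> = card (\<Union>T\<in>?I. star \<A> T)" by (intro arg_cong[of _ _ card] subset_antisym)
  also have "\<dots> \<le> (\<Sum>T\<in>?I. card (star \<A> T))" by (rule card_UN_le[OF fin])
  also have "\<dots> \<le> (\<Sum>T\<in>?I. K)" by (rule sum_mono) (use K in auto)
  also have "\<dots> = (card B choose t) * K" by (simp add: n_subsets[OF assms(2)])
  finally show ?thesis .
qed

text \<open>If a member \<open>A\<close> met \<open>B\<close> only inside \<open>T\<close>, then
  \<open>A \<inter> B\<close> would be a proper subset of \<open>T\<close>, because \<open>T\<close>
  is not contained in \<open>B\<close>, and hence too small. So \<open>A\<close> contains
  \<open>T\<close> and a further point of \<open>B - T\<close>, and stars of sets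
  \<open>insert x T\<close> cover \<open>\<A>\<close>.\<close>

lemma card_le_of_meets_extend:
  assumes "finite F" "\<A> \<subseteq> star F T" "finite T" "finite B" "\<not> T \<subseteq> B"
    and "\<And>A. A \<in> \<A> \<Longrightarrow> card T \<le> card (A \<inter> B)"
    and K: "\<And>U. finite U \<Longrightarrow> card U = Suc (card T) \<Longrightarrow> card (star F U) \<le> K"
  shows "card \<A> \<le> card B * K"
proof -
  have fin: "finite (B - T)" using assms(4) by simp
  have "\<A> \<subseteq> (\<Union>x\<in>B - T. star F (insert x T))"
  proof
    fix A assume A: "A \<in> \<A>"
    have "\<exists>x\<in>A \<inter> B. x \<notin> T"
    proof (rule ccontr)
      assume "\<not> ?thesis"
      hence "A \<inter> B \<subset> T" using assms(5) by auto
      hence "card (A \<inter> B) < card T" using assms(3) psubset_card_mono by blast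
      thus False using assms(6)[OF A] by simp
    qed
    then show "A \<in> (\<Union>x\<in>B - T. star F (insert x T))"
      using A assms(2) by (auto simp: star_def)
  qed
  hence "card \<A> \<le> card (\<Union>x\<in>B - T. star F (insert x T))"
    by (rule card_mono[rotated]) (use fin assms(1) in \<open>auto simp: star_def\<close>)
  also have "\<dots> \<le> (\<Sum>x\<in>B - T. card (star F (insert x T)))" by (rule card_UN_le[OF fin])
  also have "\<dots> \<le> (\<Sum>x\<in>B - T. K)" by (rule sum_mono) (use K assms(3) in auto)
  also have "\<dots> \<le> card B * K" by (simp add: card_mono[OF assms(4)])
  finally show ?thesis .
qed

section \<open>Two cross-\<open>t\<close>-intersecting families\<close>

text \<open>The mixed case: \<open>\<B>\<close> lies in the star of \<open>T\<close>, but some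
  \<open>A\<close> in \<open>\<A>\<close> misses part of \<open>T\<close>. Meeting this
  \<open>A\<close> forces every member of \<open>\<B>\<close> into the star of a
  \<open>(t+1)\<close>-set, at cost \<open>r\<close>; covering \<open>\<A>\<close> by stars costs
  \<open>s choose t\<close>. The total cost is at most \<open>d\<close>, which the gap between
  \<open>M'\<close> and \<open>M\<close> outweighs.\<close>

lemma cross_pair_half_star:
  fixes F G :: "'a set set"
  assumes "finite F" "finite G"
    and F: "\<And>A. A \<in> F \<Longrightarrow> finite A \<and> card A = r" and G: "\<And>B. B \<in> G \<Longrightarrow> finite B \<and> card B = s"
    and L: "\<And>T. finite T \<Longrightarrow> card T = t \<Longrightarrow> card (star F T) \<le> L"
    and M': "\<And>U. finite U \<Longrightarrow> card U = Suc t \<Longrightarrow> card (star G U) \<le> M'"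
    and d: "r * (s choose t) \<le> d" "d * M' < M"
    and sub: "\<A> \<subseteq> F" "\<B> \<subseteq> G" and ne: "\<B> \<noteq> {}"
    and cross: "\<And>A B. A \<in> \<A> \<Longrightarrow> B \<in> \<B> \<Longrightarrow> t \<le> card (A \<inter> B)"
    and T: "finite T" "card T = t" "\<B> \<subseteq> star G T" "\<not> \<A> \<subseteq> star F T" and "0 < L"
  shows "card \<A> * card \<B> < L * M"
proof -
  obtain A where A: "A \<in> \<A>" "\<not> T \<subseteq> A" using T sub by (auto simp: star_def)
  obtain B where B: "B \<in> \<B>" using ne by auto
  have meets: "card T \<le> card (B \<inter> A)" if "B \<in> \<B>" for B
    using cross[OF A(1) that] T(2) by (simp add: Int_commute)
  have "card \<B> \<le> card A * M'"
  proof (rule card_le_of_meets_extend[of G \<B> T])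
    show "finite A" using A sub F by blast
  qed (use A(2) T(1-3) M' meets assms(2) in auto)
  hence 1: "card \<B> \<le> r * M'" using A sub F by auto
  have "card \<A> \<le> (card B choose t) * L"
  proof (rule card_le_of_meets)
    fix T assume "T \<subseteq> B" "card T = t"
    moreover have "finite B" using B sub G by auto
    ultimately have "card (star F T) \<le> L" using L finite_subset by blast
    moreover have "card (star \<A> T) \<le> card (star F T)"
      by (rule card_mono) (use assms(1) sub in \<open>auto simp: star_def\<close>)
    ultimately show "card (star \<A> T) \<le> L" by simp
  qed (use B sub G cross assms(1) in \<open>auto intro: finite_subset\<close>)
  hence 2: "card \<A> \<le> (s choose t) * L" using B sub G by auto
  have "card \<A> * card \<B> \<le> ((s choose t) * L) * (r * M')" using 1 2 by (intro mult_le_mono)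
  also have "\<dots> = L * (r * (s choose t) * M')" by simp
  also have "\<dots> \<le> L * (d * M')" using d(1) by (intro mult_le_mono order_refl)
  also have "\<dots> < L * M" using d(2) \<open>0 < L\<close> by simp
  finally show ?thesis .
qed

text \<open>Two covers in succession: first by the \<open>t\<close>-subsets \<open>T\<close> of
  \<open>B\<close>, then, as no \<open>t\<close>-set lies in all of \<open>\<B>\<close>, each star
  of such a \<open>T\<close> is split again using a member \<open>C\<close> of \<open>\<B>\<close>
  that does not contain \<open>T\<close>.\<close>

lemma cross_pair_card_le:
  assumes "finite F" "finite \<A>" "\<A> \<subseteq> F"
    and K: "\<And>U. finite U \<Longrightarrow> card U = Suc t \<Longrightarrow> card (star F U) \<le> K"
    and B: "B \<in> \<B>" "\<And>B. B \<in> \<B> \<Longrightarrow> finite B \<and> card B = s"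
    and cross: "\<And>A B. A \<in> \<A> \<Longrightarrow> B \<in> \<B> \<Longrightarrow> t \<le> card (A \<inter> B)"
    and T: "\<And>T. finite T \<Longrightarrow> card T = t \<Longrightarrow> \<not> \<B> \<subseteq> star G T" and "\<B> \<subseteq> G"
  shows "card \<A> \<le> (s choose t) * (s * K)"
proof -
  have "card \<A> \<le> (card B choose t) * (s * K)"
  proof (rule card_le_of_meets)
    fix T assume TB: "T \<subseteq> B" "card T = t"
    hence finT: "finite T" using B(1) B(2)[of B] finite_subset by blast
    obtain C where C: "C \<in> \<B>" "\<not> T \<subseteq> C"
      using T[OF finT TB(2)] \<open>\<B> \<subseteq> G\<close> by (auto simp: star_def)
    have "card (star \<A> T) \<le> card C * K"
      using C finT TB B cross assms(1,3) K
      by (intro card_le_of_meets_extend[of F _ T C]) (auto simp: star_def)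
    thus "card (star \<A> T) \<le> s * K" using C B by auto
  qed (use assms in auto)
  thus ?thesis using B by auto
qed

text \<open>The cases are: a family is empty and the product is 0; exactly one or both lie in a star
  of a \<open>t\<close>-set, where either the same set serves both or the half-star bound applies;
  neither does, and then both factors are lossy.\<close>

lemma cross_pair:
  fixes F G :: "'a set set"
  assumes "finite F" "finite G"
    and F: "\<And>A. A \<in> F \<Longrightarrow> finite A \<and> card A = r" and G: "\<And>B. B \<in> G \<Longrightarrow> finite B \<and> card B = s"
    and L: "\<And>T. finite T \<Longrightarrow> card T = t \<Longrightarrow> card (star F T) \<le> L"
    and L': "\<And>U. finite U \<Longrightarrow> card U = Suc t \<Longrightarrow> card (star F U) \<le> L'"
    and M: "\<And>T. finite T \<Longrightarrow> card T = t \<Longrightarrow> card (star G T) \<le> M"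
    and M': "\<And>U. finite U \<Longrightarrow> card U = Suc t \<Longrightarrow> card (star G U) \<le> M'"
    and d: "r * (s choose t) \<le> d" "s * (r choose t) \<le> d" "d * L' < L" "d * M' < M"
    and sub: "\<A> \<subseteq> F" "\<B> \<subseteq> G"
    and cross: "\<And>A B. A \<in> \<A> \<Longrightarrow> B \<in> \<B> \<Longrightarrow> t \<le> card (A \<inter> B)"
  obtains "card \<A> * card \<B> < L * M"
  | T where "finite T" "card T = t" "\<A> \<subseteq> star F T" "\<B> \<subseteq> star G T"
proof -
  have pos: "0 < L" "0 < M" using d by auto
  have fin: "finite \<A>" "finite \<B>" using sub assms(1,2) finite_subset by blast+
  have cross': "t \<le> card (B \<inter> A)" if "A \<in> \<A>" "B \<in> \<B>" for A B
    using cross[OF that] by (simp add: Int_commute)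
  consider "\<A> = {} \<or> \<B> = {}"
    | T where "\<A> \<noteq> {}" "\<B> \<noteq> {}" "finite T" "card T = t" "\<B> \<subseteq> star G T"
    | T where "\<A> \<noteq> {}" "\<B> \<noteq> {}" "finite T" "card T = t" "\<A> \<subseteq> star F T"
    | "\<A> \<noteq> {}" "\<B> \<noteq> {}" "\<And>T. finite T \<Longrightarrow> card T = t \<Longrightarrow> \<not> \<B> \<subseteq> star G T"
      "\<And>T. finite T \<Longrightarrow> card T = t \<Longrightarrow> \<not> \<A> \<subseteq> star F T"
    by metis
  then show ?thesis
  proof cases
    case 1
    then show ?thesis using pos that(1) by auto
  next
    case (2 T)
    show ?thesis
    proof (cases "\<A> \<subseteq> star F T")
      case True
      then show ?thesis using 2 that(2) by blast
    next
      case False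
      have "card \<A> * card \<B> < L * M"
        using False 2 pos cross sub d assms(1,2) F G L M'
        by (intro cross_pair_half_star[of F G r s t L M' d M \<A> \<B> T]) auto
      then show ?thesis by (rule that(1))
    qed
  next
    case (3 T)
    show ?thesis
    proof (cases "\<B> \<subseteq> star G T")
      case True
      then show ?thesis using 3 that(2) by blast
    next
      case False
      have "card \<B> * card \<A> < M * L"
        using False 3 pos cross' sub d assms(1,2) F G M L'
        by (intro cross_pair_half_star[of G F s r t M L' d L \<B> \<A> T]) auto
      then show ?thesis by (intro that(1)) (simp add: mult.commute)
    qed
  next
    case 4
    then obtain A B where AB: "A \<in> \<A>" "B \<in> \<B>" by blast
    have 1: "card \<A> \<le> (s choose t) * (s * L')"
      by (rule cross_pair_card_le[of F _ _ _ B \<B> s G]) (use fin assms(1) sub AB F G L' cross 4 in auto)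
    have 2: "card \<B> \<le> (r choose t) * (r * M')"
      by (rule cross_pair_card_le[of G _ _ _ A \<A> r F]) (use fin assms(2) sub AB F G M' cross' 4 in auto)
    have "card \<A> * card \<B> \<le> ((s choose t) * (s * L')) * ((r choose t) * (r * M'))"
      using 1 2 by (rule mult_mono) auto
    \<comment> \<open>The constants are regrouped across the two bounds, since \<open>d\<close>
      controls only the mixed products \<open>s * (r choose t)\<close> and
      \<open>r * (s choose t)\<close>.\<close>
    also have "\<dots> = (s * (r choose t) * L') * (r * (s choose t) * M')" by simp
    also have "\<dots> \<le> (d * L') * (d * M')" using d by (intro mult_le_mono order_refl)
    also have "\<dots> < L * M" using d(3,4) by (rule mult_strict_mono) (use pos in auto)
    finally show ?thesis by (rule that(1))
  qed
qed

section \<open>From pairs to \<open>k\<close> families\<close>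

text \<open>Each index occurs in \<open>2 * (card I - 1)\<close> ordered pairs of distinct indices:
  equally often as first and as second entry.\<close>

lemma prod_pairs_eq_power:
  fixes a :: "'a \<Rightarrow> nat"
  assumes "finite I" "2 \<le> card I"
  shows "(\<Prod>i\<in>I. \<Prod>j\<in>I - {i}. a i * a j) = (\<Prod>i\<in>I. a i) ^ (2 * (card I - 1))"
proof -
  let ?P = "\<Prod>i\<in>I. a i"
  obtain m where m: "card I = m + 2" using assms(2) by (metis add.commute le_Suc_ex)
  \<comment> \<open>Of the \<open>m + 1\<close> copies of \<open>a i\<close>, one completes the
    product over \<open>I - {i}\<close> to \<open>?P\<close>.\<close>
  have "(\<Prod>j\<in>I - {i}. a i * a j) = a i ^ m * ?P" if "i \<in> I" for i
  proof -
    have "(\<Prod>j\<in>I - {i}. a i * a j) = a i ^ Suc m * prod a (I - {i})"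
      using that assms(1) m by (simp add: prod.distrib card_Diff_singleton)
    also have "\<dots> = a i ^ m * ?P"
      using that assms(1) by (simp add: prod.remove[of I i] mult_ac)
    finally show ?thesis .
  qed
  hence "(\<Prod>i\<in>I. \<Prod>j\<in>I - {i}. a i * a j) = (\<Prod>i\<in>I. a i ^ m * ?P)" by simp
  also have "\<dots> = ?P ^ m * ?P ^ (m + 2)"
    by (simp add: prod.distrib prod_power_distrib m)
  also have "\<dots> = ?P ^ (2 * (card I - 1))"
    by (simp add: m flip: power_add) (simp add: mult_2)
  finally show ?thesis .
qed

text \<open>Multiplying the inequalities over all ordered pairs compares equal powers of the two
  products, and the exponent is positive. One strict pair would make the whole comparison strict,
  because every \<open>b i\<close> is positive.\<close>

lemma prod_le_of_pairs:
  fixes a b :: "'a \<Rightarrow> nat"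
  assumes "finite I" "2 \<le> card I" and pos: "\<And>i. i \<in> I \<Longrightarrow> 0 < b i"
    and le: "\<And>i j. i \<in> I \<Longrightarrow> j \<in> I \<Longrightarrow> i \<noteq> j \<Longrightarrow> a i * a j \<le> b i * b j"
  shows "prod a I \<le> prod b I"
    and "prod a I = prod b I \<Longrightarrow> i \<in> I \<Longrightarrow> j \<in> I \<Longrightarrow> i \<noteq> j \<Longrightarrow> a i * a j = b i * b j"
proof -
  have inner: "(\<Prod>j\<in>I - {i}. a i * a j) \<le> (\<Prod>j\<in>I - {i}. b i * b j)" if "i \<in> I" for i
    using le that by (intro prod_mono) auto
  have ipos: "0 < (\<Prod>j\<in>I - {i}. b i * b j)" if "i \<in> I" for i
    using pos that by (intro prod_pos) auto
  have "prod a I ^ (2 * (card I - 1)) \<le> prod b I ^ (2 * (card I - 1))"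
    unfolding prod_pairs_eq_power[OF assms(1,2), symmetric] using inner by (intro prod_mono) auto
  thus "prod a I \<le> prod b I" using assms(2) by (subst (asm) power_mono_iff) auto
  show "a i * a j = b i * b j" if "prod a I = prod b I" "i \<in> I" "j \<in> I" "i \<noteq> j"
  proof (rule ccontr)
    assume "a i * a j \<noteq> b i * b j"
    hence "a i * a j < b i * b j" using le[of i j] that by simp
    hence "(\<Prod>j\<in>I - {i}. a i * a j) < (\<Prod>j\<in>I - {i}. b i * b j)"
    proof (intro prod_mono_strict[of j _ "\<lambda>j. a i * a j"])
      show "0 \<le> a i * a l \<and> a i * a l \<le> b i * b l" if "l \<in> I - {i}" for l
        using le[of i l] that \<open>i \<in> I\<close> by auto
    qed (use that pos assms(1) in auto)
    hence "(\<Prod>i\<in>I. \<Prod>j\<in>I - {i}. a i * a j) < (\<Prod>i\<in>I. \<Prod>j\<in>I - {i}. b i * b j)"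
      using that inner ipos assms(1) by (intro prod_mono_strict[of i _ "\<lambda>i. \<Prod>j\<in>I - {i}. a i * a j"]) auto
    thus False by (simp add: prod_pairs_eq_power[OF assms(1,2)] that(1))
  qed
qed

text \<open>Separates the combinatorics from the counting: for uniform families it suffices that one
  set \<open>S\<close> attains the maximal star size \<open>L i\<close> in every family at once, and
  that the drop from \<open>L i\<close> to \<open>L' i\<close> exceeds the factor
  \<open>d\<close>.\<close>

lemma extrastrong_cross_star_of_bounds:
  fixes F :: "nat \<Rightarrow> 'a set set"
  assumes "2 \<le> k" and fin: "\<And>i. i \<in> {1..k} \<Longrightarrow> finite (F i)"
    and F: "\<And>i A. i \<in> {1..k} \<Longrightarrow> A \<in> F i \<Longrightarrow> finite A \<and> card A = r i"
    and S: "finite S" "card S = t" "\<And>i. i \<in> {1..k} \<Longrightarrow> card (star (F i) S) = L i"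
    and L: "\<And>i T. i \<in> {1..k} \<Longrightarrow> finite T \<Longrightarrow> card T = t \<Longrightarrow> card (star (F i) T) \<le> L i"
    and L': "\<And>i U. i \<in> {1..k} \<Longrightarrow> finite U \<Longrightarrow> card U = Suc t \<Longrightarrow> card (star (F i) U) \<le> L' i"
    and d: "\<And>i j. i \<in> {1..k} \<Longrightarrow> j \<in> {1..k} \<Longrightarrow> i \<noteq> j \<Longrightarrow> r i * (r j choose t) \<le> d"
      "\<And>i. i \<in> {1..k} \<Longrightarrow> d * L' i < L i" "1 \<le> d"
  shows "extrastrong_cross_star t k F"
proof -
  have pos: "0 < L i" if "i \<in> {1..k}" for i using d(2)[OF that] by simp
  have main: "(\<Prod>i\<in>{1..k}. card (\<A> i)) \<le> (\<Prod>i\<in>{1..k}. L i) \<and>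
      ((\<Prod>i\<in>{1..k}. card (\<A> i)) = (\<Prod>i\<in>{1..k}. L i) \<longrightarrow>
        (\<exists>T'. finite T' \<and> card T' = t \<and> (\<forall>i\<in>{1..k}. \<A> i = star (F i) T')))"
    if "tuple_below k \<A> F" "cross_intersecting t k \<A>" for \<A>
  proof -
    have below: "\<A> i \<subseteq> F i" if "i \<in> {1..k}" for i
      using \<open>tuple_below k \<A> F\<close> that by (auto simp: tuple_below_def)
    have pair: "card (\<A> i) * card (\<A> j) < L i * L j \<or>
        (\<exists>T. finite T \<and> card T = t \<and> \<A> i \<subseteq> star (F i) T \<and> \<A> j \<subseteq> star (F j) T)"
      if ij: "i \<in> {1..k}" "j \<in> {1..k}" "i \<noteq> j" for i j
    proof (rule cross_pair[of "F i" "F j" "r i" "r j" t "L i" "L' i" "L j" "L' j" d "\<A> i" "\<A> j"])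
      show "t \<le> card (A \<inter> B)" if "A \<in> \<A> i" "B \<in> \<A> j" for A B
        using \<open>cross_intersecting t k \<A>\<close> ij that unfolding cross_intersecting_def by blast
    qed (use ij fin F L L' d below in auto)
    have card_le: "card (\<A> i) \<le> card (star (F i) T)" "card (star (F i) T) \<le> L i"
      if "i \<in> {1..k}" "finite T" "card T = t" "\<A> i \<subseteq> star (F i) T" for i T
      using that fin L by (auto intro!: card_mono simp: star_def)
    have pair_le: "card (\<A> i) * card (\<A> j) \<le> L i * L j"
      if ij: "i \<in> {1..k}" "j \<in> {1..k}" "i \<noteq> j" for i j
      using pair[OF ij]
    proof
      assume "\<exists>T. finite T \<and> card T = t \<and> \<A> i \<subseteq> star (F i) T \<and> \<A> j \<subseteq> star (F j) T"
      then obtain T where T: "finite T" "card T = t" "\<A> i \<subseteq> star (F i) T" "\<A> j \<subseteq> star (F j) T"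
        by blast
      show ?thesis
        using card_le[OF ij(1) T(1,2,3)] card_le[OF ij(2) T(1,2,4)] by (intro mult_le_mono) auto
    qed simp
    have I: "finite {1..k}" "2 \<le> card {1..k}" using \<open>2 \<le> k\<close> by auto
    note prods = prod_le_of_pairs[OF I, of L "\<lambda>i. card (\<A> i)"]
    have "\<exists>T'. finite T' \<and> card T' = t \<and> (\<forall>i\<in>{1..k}. \<A> i = star (F i) T')"
      if eq: "(\<Prod>i\<in>{1..k}. card (\<A> i)) = (\<Prod>i\<in>{1..k}. L i)"
    proof -
      \<comment> \<open>Equality of the full products gives equality for each pair, which rules out
        the strict alternative in \<open>pair\<close>. Both families then lie in stars of one
        \<open>T\<close>, and since no factor exceeds its bound, both fill these stars.\<close>
      have ex: "\<exists>T. finite T \<and> card T = t \<and> \<A> i = star (F i) T \<and> \<A> j = star (F j) T \<and>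
          card (\<A> i) = L i"
        if ij: "i \<in> {1..k}" "j \<in> {1..k}" "i \<noteq> j" for i j
      proof -
        have peq: "card (\<A> i) * card (\<A> j) = L i * L j"
          using prods(2)[OF pos pair_le eq] ij by blast
        then obtain T where T: "finite T" "card T = t" "\<A> i \<subseteq> star (F i) T" "\<A> j \<subseteq> star (F j) T"
          using pair[OF ij] by auto
        note ci = card_le[OF ij(1) T(1,2,3)] and cj = card_le[OF ij(2) T(1,2,4)]
        have "card (\<A> i) = L i"
        proof (rule ccontr)
          assume "card (\<A> i) \<noteq> L i"
          hence "card (\<A> i) * L j < L i * L j" using ci pos[OF ij(2)] by simp
          moreover have "card (\<A> i) * card (\<A> j) \<le> card (\<A> i) * L j" using cj by simp
          ultimately show False using peq by simp
        qed
        moreover have "card (\<A> j) = L j" using peq calculation pos[OF ij(1)] by auto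
        ultimately have "\<A> i = star (F i) T" "\<A> j = star (F j) T"
          using ci cj T ij fin \<open>card (\<A> i) = L i\<close>
          by (simp_all add: card_subset_eq finite_star)
        thus ?thesis using T \<open>card (\<A> i) = L i\<close> by blast
      qed
      have one: "1 \<in> {1..k}" "2 \<in> {1..k}" using \<open>2 \<le> k\<close> by auto
      obtain T where T: "finite T" "card T = t" "\<A> 1 = star (F 1) T" "card (\<A> 1) = L 1"
        using ex[OF one] by auto
      have "\<A> j = star (F j) T" if j: "j \<in> {1..k}" for j
      proof (cases "j = 1")
        case False
        obtain S where S: "finite S" "card S = t" "\<A> 1 = star (F 1) S" "\<A> j = star (F j) S"
          using ex[OF one(1) j] False by auto
        \<comment> \<open>The \<open>t\<close>-set found for the pair \<open>1, j\<close> could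
          depend on \<open>j\<close>. If it differed from \<open>T\<close>, the family
          \<open>\<A> 1\<close> would lie in the star of a \<open>(t+1)\<close>-set, of size at most
          \<open>L' 1 < L 1\<close>.\<close>
        have "S = T"
        proof (rule ccontr)
          assume "S \<noteq> T"
          then obtain x where x: "x \<in> S" "x \<notin> T"
            using S T card_subset_eq by (metis subsetI)
          have "\<A> 1 \<subseteq> star (F 1) (insert x T)" using x S(3) T(3) by (auto simp: star_def)
          hence "L 1 \<le> card (star (F 1) (insert x T))"
            unfolding T(4)[symmetric] using fin[OF one(1)] by (intro card_mono) (auto simp: star_def)
          also have "\<dots> \<le> L' 1" using x T one by (intro L') auto
          also have "\<dots> \<le> d * L' 1" using d(3) by simp
          finally show False using d(2)[OF one(1)] by simp
        qed
        thus ?thesis using S by simp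
      qed (use T in simp)
      thus ?thesis using T by blast
    qed
    moreover have "(\<Prod>i\<in>{1..k}. card (\<A> i)) \<le> (\<Prod>i\<in>{1..k}. L i)"
      using prods(1)[OF pos pair_le] by blast
    ultimately show ?thesis by blast
  qed
  have "(\<Prod>i\<in>{1..k}. card (star (F i) S)) = (\<Prod>i\<in>{1..k}. L i)" using S by (intro prod.cong) auto
  thus ?thesis unfolding extrastrong_cross_star_def using main S(1,2)
    by (intro exI[of _ S]) auto
qed

section \<open>Star sizes in families of represented multisets\<close>

lemma mset_rep_eq_Sigma: "mset_rep A = (SIGMA a:set_mset A. {1..count A a})"
  by (auto simp: mset_rep_def)

lemma finite_mset_rep [simp]: "finite (mset_rep A)"
  by (simp add: mset_rep_eq_Sigma)

lemma card_mset_rep [simp]: "card (mset_rep A) = size A"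
  by (simp add: mset_rep_eq_Sigma size_multiset_overloaded_eq)

lemma mset_rep_section: "{j. (a, j) \<in> mset_rep A} = {1..count A a}"
  by (auto simp: mset_rep_def simp flip: count_greater_zero_iff)

text \<open>The multiplicity of \<open>a\<close> is the number of pairs over \<open>a\<close>.
  Injectivity lets stars be counted as collections of multisets.\<close>

lemma inj_mset_rep: "inj mset_rep"
proof (rule injI, rule multiset_eqI)
  fix A B :: "'a multiset" and a assume "mset_rep A = mset_rep B"
  hence "{1..count A a} = {1..count B a}" by (metis mset_rep_section)
  thus "count A a = count B a" by (metis card_atLeastAtMost diff_Suc_1)
qed

lemma finite_mset_family [simp]: "finite (mset_family n r)"
  by (auto simp: mset_family_def)

lemma card_star_mset_family:
  "card (star (mset_family n r) U) = card {A \<in> multisets_of_size {1..n} r. U \<subseteq> mset_rep A}"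
proof -
  have "star (mset_family n r) U = mset_rep ` {A \<in> multisets_of_size {1..n} r. U \<subseteq> mset_rep A}"
    by (auto simp: star_def mset_family_def)
  thus ?thesis by (simp add: card_image[OF inj_on_subset[OF inj_mset_rep]])
qed

lemma card_star_mset_family_le:
  assumes "finite U" "card U \<le> r"
  shows "card (star (mset_family n r) U) \<le> card (multisets_of_size {1..n} (r - card U))"
proof -
  \<comment> \<open>Forgetting the copy numbers turns \<open>U\<close> into a submultiset of every \<open>A\<close> with \<open>U \<subseteq> S\<^sub>A\<close>.\<close>
  define D where "D = image_mset fst (mset_set U)"
  have cD: "count D a = card {x \<in> U. fst x = a}" for a
    using assms(1) by (simp add: D_def count_image_mset' eq_commute)
  have sub: "D \<subseteq># A" if "U \<subseteq> mset_rep A" for A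
  proof (rule mset_subset_eqI)
    fix a
    have "{x \<in> U. fst x = a} \<subseteq> Pair a ` {j. (a, j) \<in> mset_rep A}" using that by force
    hence "card {x \<in> U. fst x = a} \<le> card (Pair a ` {1..count A a})"
      unfolding mset_rep_section by (rule card_mono[rotated]) simp
    also have "\<dots> \<le> count A a" using card_image_le[of "{1..count A a}" "Pair a"] by simp
    finally show "count D a \<le> count A a" by (simp add: cD)
  qed
  let ?S = "{A \<in> multisets_of_size {1..n} r. U \<subseteq> mset_rep A}"
  \<comment> \<open>As \<open>D\<close> is contained in \<open>A\<close>, adding it back recovers
    \<open>A\<close>; removing it lowers the size by exactly \<open>card U\<close>.\<close>
  have "inj_on (\<lambda>A. A - D) ?S"
    by (rule inj_onI) (metis (mono_tags, lifting) mem_Collect_eq sub subset_mset.diff_add)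
  moreover have "(\<lambda>A. A - D) ` ?S \<subseteq> multisets_of_size {1..n} (r - card U)"
  proof (rule image_subsetI)
    fix A assume "A \<in> ?S"
    hence A: "set_mset A \<subseteq> {1..n}" "size A = r" "U \<subseteq> mset_rep A" by (auto simp: multisets_of_size_def)
    have "size (A - D) = r - card U" using A sub[OF A(3)] by (simp add: size_Diff_submset D_def)
    moreover have "set_mset (A - D) \<subseteq> {1..n}" using A(1) in_diffD by fastforce
    ultimately show "A - D \<in> multisets_of_size {1..n} (r - card U)"
      by (simp add: multisets_of_size_def)
  qed
  ultimately show ?thesis unfolding card_star_mset_family by (rule card_inj_on_le) auto
qed

lemma star_mset_family_empty:
  assumes "r < card U"
  shows "star (mset_family n r) U = {}"
proof -
  have "card U \<le> r" if "A \<in> multisets_of_size {1..n} r" "U \<subseteq> mset_rep A" for A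
    using that card_mono[of "mset_rep A" U] by (simp add: multisets_of_size_def)
  thus ?thesis using assms by (force simp: star_def mset_family_def)
qed

text \<open>The general upper bound is attained by the first \<open>t\<close> copies of the member
  1: adding \<open>t\<close> copies of 1 to any multiset of size \<open>r - t\<close> yields one
  whose representation contains this column.\<close>

lemma card_star_mset_family_column:
  assumes "t \<le> r" "1 \<le> n"
  shows "card (star (mset_family n r) (Pair 1 ` {1..t})) = card (multisets_of_size {1..n} (r - t))"
proof (rule antisym)
  have c: "card (Pair 1 ` {1..t} :: (nat \<times> nat) set) = t" by (simp add: card_image inj_on_def)
  show "card (star (mset_family n r) (Pair 1 ` {1..t})) \<le> card (multisets_of_size {1..n} (r - t))"
    using card_star_mset_family_le[of "Pair 1 ` {1..t}" r n] c assms(1) by simp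
  let ?f = "\<lambda>B. B + replicate_mset t (1::nat)"
  have "?f ` multisets_of_size {1..n} (r - t)
      \<subseteq> {A \<in> multisets_of_size {1..n} r. Pair 1 ` {1..t} \<subseteq> mset_rep A}"
    using assms by (auto simp: multisets_of_size_def mset_rep_def split: if_splits)
  moreover have "inj_on ?f (multisets_of_size {1..n} (r - t))" by (auto intro: inj_onI)
  ultimately show "card (multisets_of_size {1..n} (r - t))
      \<le> card (star (mset_family n r) (Pair 1 ` {1..t}))"
    unfolding card_star_mset_family
    by (intro card_inj_on_le[of ?f]) (auto intro: finite_subset[OF _ finite_multisets_of_size])
qed

text \<open>By stars and bars and the absorption identity for binomials, the ratio of the two counts
  is \<open>(n + m - 1) / m\<close>, which exceeds \<open>d\<close> once \<open>n\<close> is at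
  least \<open>m * d + 1\<close>.\<close>

lemma card_multisets_of_size_ratio:
  assumes "0 < m" "m * d + 1 \<le> n"
  shows "d * card (multisets_of_size {1..n} (m - 1)) < card (multisets_of_size {1..n} m)"
proof -
  let ?L = "card (multisets_of_size {1..n} m)" and ?L' = "card (multisets_of_size {1..n} (m - 1))"
  have L: "?L = (n + m - 1) choose m" and L': "?L' = (n + m - 1 - 1) choose (m - 1)"
    using assms by (simp_all add: card_multisets_of_size)
  have "0 < ?L'" unfolding L' using assms by (simp add: zero_less_binomial_iff)
  have "m * (d * ?L') < (n + m - 1) * ?L'"
    using \<open>0 < ?L'\<close> assms by (simp add: mult.assoc[symmetric])
  also have "\<dots> = m * ?L" unfolding L L' using assms(1) by (rule times_binomial_minus1_eq[symmetric])
  finally show ?thesis by simp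
qed

section \<open>The threshold on \<open>n i\<close> and the choice of constants\<close>

theorem theorem4p9:
  fixes t k :: nat and r n :: "nat \<Rightarrow> nat"
  assumes "k \<ge> 2" and "1 \<le> t" and "t \<le> r 1"
    and "\<And>i j. 1 \<le> i \<Longrightarrow> i \<le> j \<Longrightarrow> j \<le> k \<Longrightarrow> r i \<le> r j"
    and "\<And>i. i \<in> {1..k} \<Longrightarrow>
      int (n i) \<ge> (int (r i) - int t) * int (c_bound (r (k - 1)) (r k) t) - int (r i) + int t + 1"
  shows "extrastrong_cross_star t k (\<lambda>i. mset_family (n i) (r i))"
proof -
  define d where "d = max (r (k - 1) * (r k choose t)) (r k * (r (k - 1) choose t))"
  have tr: "t \<le> r i" if "i \<in> {1..k}" for i
    using assms(4)[of 1 i] assms(3) that by simp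
  have c: "c_bound (r (k - 1)) (r k) t = d + 1"
    using tr[of k] tr[of "k - 1"] assms(1) by (simp add: c_bound_def d_def)
  \<comment> \<open>With \<open>c_bound\<close> written as \<open>d + 1\<close>, the summand
    \<open>r i - t\<close> that it contributes cancels against \<open>- r i + t\<close>.\<close>
  have n: "(r i - t) * d + 1 \<le> n i" if "i \<in> {1..k}" for i
  proof -
    have "int ((r i - t) * d + 1) = (int (r i) - int t) * int (d + 1) - int (r i) + int t + 1"
      using tr[OF that] by (simp add: of_nat_diff algebra_simps)
    also have "\<dots> \<le> int (n i)" using assms(5)[OF that] c by simp
    finally show ?thesis by (simp only: of_nat_le_iff)
  qed
  \<comment> \<open>Of two distinct indices the smaller is at most \<open>k - 1\<close> and the
    larger at most \<open>k\<close>, so the two entries of the maximum defining \<open>d\<close>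
    cover the two orders.\<close>
  have mono: "r i * (r j choose t) \<le> d" if "i \<in> {1..k}" "j \<in> {1..k}" "i \<noteq> j" for i j
  proof (cases "i < j")
    case True
    have "r i * (r j choose t) \<le> r (k - 1) * (r k choose t)"
      using True that assms(4) by (intro mult_le_mono binomial_right_mono) auto
    thus ?thesis by (simp add: d_def)
  next
    case False
    have "r i * (r j choose t) \<le> r k * (r (k - 1) choose t)"
      using False that assms(4) by (intro mult_le_mono binomial_right_mono) auto
    thus ?thesis by (simp add: d_def)
  qed
  have "1 \<le> d"
  proof -
    have "0 < r k * (r (k - 1) choose t)" using tr[of k] tr[of "k - 1"] assms(1,2) by simp
    moreover have "\<dots> \<le> d" by (simp add: d_def)
    ultimately show ?thesis by linarith
  qed
  let ?T = "Pair 1 ` {1..t} :: (nat \<times> nat) set"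
  let ?L = "\<lambda>i. card (multisets_of_size {1..n i} (r i - t))"
  \<comment> \<open>For \<open>r i = t\<close> no member contains a \<open>(t+1)\<close>-set.
    Truncated subtraction would give the bound 1 there, which is too weak: \<open>?L i\<close> is 1
    as well, and \<open>d\<close> is at least 1.\<close>
  let ?L' = "\<lambda>i. if r i = t then 0 else card (multisets_of_size {1..n i} (r i - t - 1))"
  show ?thesis
  proof (rule extrastrong_cross_star_of_bounds[where r = r and S = "?T" and L = "?L" and L' = "?L'"
        and d = d])
    fix i assume i: "i \<in> {1..k}"
    show "finite A \<and> card A = r i" if "A \<in> mset_family (n i) (r i)" for A
      using that by (auto simp: mset_family_def multisets_of_size_def)
    show "card (star (mset_family (n i) (r i)) ?T) = ?L i"
      using n[OF i] tr[OF i] by (intro card_star_mset_family_column) auto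
    show "card (star (mset_family (n i) (r i)) T) \<le> ?L i" if "finite T" "card T = t" for T
      using card_star_mset_family_le[of T "r i" "n i"] that tr[OF i] by simp
    show "card (star (mset_family (n i) (r i)) U) \<le> ?L' i" if "finite U" "card U = Suc t" for U
      using card_star_mset_family_le[of U "r i" "n i"] star_mset_family_empty[of "r i" U "n i"]
        that tr[OF i] by auto
    show "d * ?L' i < ?L i"
      using card_multisets_of_size_ratio[of "r i - t" d "n i"] n[OF i] tr[OF i] by simp
  qed (use assms(1) mono \<open>1 \<le> d\<close> in \<open>auto simp: card_image inj_on_def\<close>)
qed

end
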